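(* Let $K$ be a non-Archimedean local field with residue field cardinality $q$, and let $\varphi\in L^1_{\mathrm{loc}}(K)$ be a radial function with Laplace type transform $$ \widetilde{\varphi}(|\xi|_K)=\int\limits_K v_0(|x\xi|_K)\varphi(|x|_K)\,dx . $$ Then for each $m=1,2,\ldots$, $$ \varphi(q^m)=\varphi(1)+\sum_{j=0}^{m-1}q^{-j}\left[\widetilde\varphi(q^{-j+1})-\widetilde\varphi(q^{-j})\right] $$ and $$ \varphi(q^{-m})=\varphi(1)+\sum_{j=1}^{m}q^{j}\left[\widetilde\varphi(q^{j})-\widetilde\varphi(q^{j+1})\right]. $$
   Context: $K$ is a non-Archimedean local field (a non-discrete totally disconnected locally compact topological field) with absolute value $|\cdot|_K$, $q$ is the cardinality of its residue field, and the absolute value is normalized so that its nonzero values are exactly $q^N$, $N\in\mathbb Z$. $dx$ is the Haar measure on the additive group of $K$ normalized so that the unit ball $\{|x|_K\le1\}$ has measure $1$. A radial function is a complex-valued function $\varphi=\varphi(|x|_K)$ depending only on $|x|_K$; it is identified with a function on the set $q^{\mathbb Z}=\{q^n:n\in\mathbb Z\}$. The function $v_0$ is $$ v_0(|x|_K)=\begin{cases}1,&|x|_K\le1,\\ -\frac1{q-1},&|x|_K=q,\\ 0,&|x|_K\ge q^2.\end{cases} $$ The transform $\widetilde\varphi$ is considered for $\xi\in K$ with $|\xi|_K=q^N$, $N\in\mathbb Z$, so that $\widetilde\varphi$ is a function on $q^{\mathbb Z}$. *)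

theory Defs
  imports "HOL-Analysis.Analysis"
begin

locale nonarch_local_field =
  fixes K :: "'a::{field, topological_ab_group_add, topological_comm_monoid_mult,
    t2_space, perfect_space} itself"
  assumes continuous_on_inverse_nonzero: "continuous_on (- {0::'a}) inverse"
    and totally_disconnected: "connected S \<Longrightarrow> (x::'a) \<in> S \<Longrightarrow> y \<in> S \<Longrightarrow> x = y"
    and locally_compact: "locally_compact_space (euclidean :: 'a topology)"

text \<open>The residue field is the quotient of the closed unit ball by the open unit ball; only its
  cardinality is needed.\<close>

definition residue_field :: "('a::field \<Rightarrow> real) \<Rightarrow> 'a set set" where
  "residue_field av =
    {x. av x \<le> 1} // {(x, y). av x \<le> 1 \<and> av y \<le> 1 \<and> av (x - y) < 1}"

locale local_field_absolute_value =
  nonarch_local_field "TYPE('a)"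
  for av :: "'a::{field, topological_ab_group_add, topological_comm_monoid_mult,
    t2_space, perfect_space} \<Rightarrow> real" +
  assumes nonneg: "av x \<ge> 0"
    and eq_0_iff: "av x = 0 \<longleftrightarrow> x = 0"
    and mult: "av (x * y) = av x * av y"
    and ultrametric: "av (x + y) \<le> max (av x) (av y)"
    and open_iff: "open U \<longleftrightarrow> (\<forall>x\<in>U. \<exists>e>0. \<forall>y. av (y - x) < e \<longrightarrow> y \<in> U)"
    and normalized:
      "av ` (- {0}) = range (\<lambda>N::int. real (card (residue_field av)) powi N)"

definition haar_measure :: "'a::{topological_space, plus} measure \<Rightarrow> bool" where
  "haar_measure M \<longleftrightarrow>
     sets M = sets borel \<and>
     (\<forall>a. \<forall>A\<in>sets borel. emeasure M ((+) a ` A) = emeasure M A) \<and>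
     (\<forall>C. compact C \<longrightarrow> emeasure M C < \<infinity>) \<and>
     (\<forall>A\<in>sets borel. emeasure M A = (INF U\<in>{U. open U \<and> A \<subseteq> U}. emeasure M U)) \<and>
     (\<forall>U. open U \<longrightarrow> emeasure M U = (SUP C\<in>{C. compact C \<and> C \<subseteq> U}. emeasure M C)) \<and>
     emeasure M UNIV \<noteq> 0"

definition normalized_haar_measure :: "('a::{topological_space, plus} \<Rightarrow> real) \<Rightarrow> 'a measure \<Rightarrow> bool"
  where "normalized_haar_measure av M \<longleftrightarrow> haar_measure M \<and> emeasure M {x. av x \<le> 1} = 1"

definition locally_integrable ::
  "'a::topological_space measure \<Rightarrow> ('a \<Rightarrow> 'b::{banach, second_countable_topology}) \<Rightarrow> bool" where
  "locally_integrable M f \<longleftrightarrow> (\<forall>C. compact C \<longrightarrow> set_integrable M C f)"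

text \<open>Only arguments in the value set $q^{\mathbb Z}\cup\{0\}$ matter, so the last case amounts to
  arguments that are at least $q^2$.\<close>

definition v0 :: "nat \<Rightarrow> real \<Rightarrow> real" where
  "v0 q r = (if r \<le> 1 then 1 else if r = real q then - 1 / (real q - 1) else 0)"

text \<open>A radial function is represented by its profile \<open>\<phi>\<close>, the function on the field being
  \<open>\<lambda>x. \<phi> (av x)\<close>.\<close>

definition laplace_integral ::
  "('a::field \<Rightarrow> real) \<Rightarrow> 'a measure \<Rightarrow> (real \<Rightarrow> complex) \<Rightarrow> 'a \<Rightarrow> complex" where
  "laplace_integral av M \<phi> \<xi> =
    (LINT x|M. complex_of_real (v0 (card (residue_field av)) (av (x * \<xi>))) * \<phi> (av x))"

text \<open>The profile of the transform: \<open>laplace_integral\<close> depends on \<open>\<xi>\<close> only through \<open>av \<xi>\<close>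
  (lemma \<open>laplace_transform_eq\<close> below), so the choice of \<open>\<xi>\<close> is immaterial.\<close>

definition laplace_transform ::
  "('a::field \<Rightarrow> real) \<Rightarrow> 'a measure \<Rightarrow> (real \<Rightarrow> complex) \<Rightarrow> real \<Rightarrow> complex" where
  "laplace_transform av M \<phi> r = laplace_integral av M \<phi> (SOME \<xi>. av \<xi> = r)"

lemma (in local_field_absolute_value) laplace_transform_eq:
  "laplace_transform av M \<phi> (av \<xi>) = laplace_integral av M \<phi> \<xi>"
proof -
  have "av (SOME \<zeta>. av \<zeta> = av \<xi>) = av \<xi>"
    by (rule someI) (rule refl)
  then show ?thesis
    by (simp add: laplace_transform_def laplace_integral_def mult)
qed

end

theory Submission
  imports Defs
begin

text \<open>Only the balls \<open>{x. av x \<le> q ^ n}\<close> matter. Each is the disjoint union of \<open>q\<close> translates of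
  the next smaller one, so translation invariance and the normalization give it measure \<open>q ^ n\<close>.
  Writing \<open>I n\<close> for the integral of \<open>\<phi>\<close> over this ball, the transform at \<open>q ^ N\<close> is
  \<open>I (- N) - q ^ (- N) * \<phi> (q ^ (1 - N))\<close>. Its increments, multiplied by \<open>q ^ N\<close>, are the increments
  of \<open>\<phi>\<close> itself, and both formulas are telescoping sums.\<close>

context local_field_absolute_value
begin

abbreviation q where "q \<equiv> card (residue_field av)"

abbreviation level_ball where "level_ball n \<equiv> {x. av x \<le> real q powi n}"

section \<open>The absolute value and its value group\<close>

lemma av_zero [simp]: "av 0 = 0"
  by (simp add: eq_0_iff)

lemma av_pos: "x \<noteq> 0 \<Longrightarrow> av x > 0"
  using nonneg[of x] eq_0_iff[of x] by linarith

lemma av_one [simp]: "av 1 = 1"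
  using mult[of 1 1] av_pos[of 1] by simp

lemma av_minus [simp]: "av (- x) = av x"
proof -
  have "av (- 1) * av (- 1) = 1"
    using mult[of "- 1" "- 1"] by simp
  then have "av (- 1) = 1"
    using nonneg[of "- 1"] by (metis abs_of_nonneg abs_square_eq_1 power2_eq_square)
  then show ?thesis
    using mult[of "- 1" x] by simp
qed

lemma av_minus_commute: "av (x - y) = av (y - x)"
  using av_minus[of "x - y"] by simp

text \<open>An infinite residue field would have cardinality \<open>0\<close>, making \<open>0\<close> a value of \<open>av\<close> off the
  origin; cardinality \<open>1\<close> would make the topology discrete.\<close>

lemma q_ge_2: "q \<ge> 2"
proof -
  have "q \<noteq> 0"
  proof
    assume "q = 0"
    \<comment> \<open>The exponent has to be nonzero, because \<open>0 powi 0 = 1\<close>.\<close>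
    then have "0 \<in> range (\<lambda>N::int. real q powi N)"
      by (intro range_eqI[of _ _ 1]) simp
    then show False
      unfolding normalized[symmetric] using av_pos by fastforce
  qed
  moreover have "q \<noteq> 1"
  proof
    assume "q = 1"
    then have one: "av x = 1" if "x \<noteq> 0" for x
      using normalized that by auto
    have "\<exists>e>0. \<forall>y. av (y - x) < e \<longrightarrow> y \<in> {0}" if "x = 0" for x
      using that one by (intro exI[of _ 1]) force
    then have "open {0::'a}"
      using open_iff[of "{0}"] by auto
    then show False
      using not_open_singleton by blast
  qed
  ultimately show ?thesis by linarith
qed

lemma q_gt_1: "real q > 1"
  using q_ge_2 by linarith

lemma powi_less_iff: "real q powi m < real q powi n \<longleftrightarrow> m < n"
  using q_gt_1 power_int_strict_increasing[of m n "real q"] power_int_increasing[of n m "real q"]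
  by (cases "m < n") auto

lemma powi_le_iff: "real q powi m \<le> real q powi n \<longleftrightarrow> m \<le> n"
  using powi_less_iff[of n m] by linarith

lemma powi_pos: "real q powi n > 0"
  using q_gt_1 by (intro zero_less_power_int) auto

lemma av_cases:
  obtains "x = 0" | k where "x \<noteq> 0" "av x = real q powi k"
  using normalized by blast

lemma obtain_av:
  obtains x where "x \<noteq> 0" "av x = real q powi k"
proof -
  have "real q powi k \<in> av ` (- {0})"
    unfolding normalized by blast
  then show ?thesis using that by (metis ComplD imageE insertI1)
qed

text \<open>No value lies strictly between consecutive powers of \<open>q\<close>, so an open ball
  is the closed ball one level down.\<close>

lemma less_powi_iff: "av x < real q powi n \<longleftrightarrow> av x \<le> real q powi (n - 1)"
  using powi_pos[of n] powi_pos[of "n - 1"]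
  by (cases x rule: av_cases) (auto simp: powi_less_iff powi_le_iff)

section \<open>Topology of the balls\<close>

lemma open_level_ball: "open (level_ball n)"
  unfolding open_iff
proof
  fix x assume x: "x \<in> level_ball n"
  \<comment> \<open>By the ultrametric inequality, every point of a ball is a centre of it. The same
    fact shows below that the complement is open.\<close>
  have "y \<in> level_ball n" if "av (y - x) < real q powi n" for y
    using x that ultrametric[of "y - x" x] by auto
  then show "\<exists>e>0. \<forall>y. av (y - x) < e \<longrightarrow> y \<in> level_ball n"
    using powi_pos by blast
qed

lemma closed_level_ball: "closed (level_ball n)"
  unfolding closed_def open_iff
proof
  fix x assume x: "x \<in> - level_ball n"
  have "y \<in> - level_ball n" if "av (y - x) < real q powi n" for y
  proof
    assume "y \<in> level_ball n"
    then show False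
      using x that ultrametric[of "x - y" y] av_minus_commute[of x y] by auto
  qed
  then show "\<exists>e>0. \<forall>y. av (y - x) < e \<longrightarrow> y \<in> - level_ball n"
    using powi_pos by blast
qed

lemma mult_level_ball:
  assumes "av a = real q powi k"
  shows "(*) a ` level_ball n = level_ball (n + k)"
proof -
  have a: "a \<noteq> 0"
    using assms powi_pos[of k] by auto
  have add: "real q powi (n + k) = real q powi k * real q powi n"
    using q_gt_1 by (simp add: power_int_add)
  have "x \<in> (*) a ` level_ball n" if "x \<in> level_ball (n + k)" for x
  proof
    show x: "x = a * (x / a)"
      using a by simp
    have "av a * av (x / a) \<le> real q powi k * real q powi n"
      using that add mult[of a "x / a"] x by simp
    then show "x / a \<in> level_ball n"
      using assms powi_pos[of k] by simp
  qed
  then show ?thesis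
    using assms powi_pos[of k] by (auto simp: mult add)
qed

text \<open>Local compactness puts some small ball, of level \<open>- j\<close>, inside a compact
  set. Multiplication by an element of value \<open>q ^ (n + j)\<close> is continuous and carries
  that ball onto \<open>level_ball n\<close>.\<close>

lemma compact_level_ball: "compact (level_ball n)"
proof -
  obtain U C :: "'a set" where U: "open U" "0 \<in> U" and C: "compact C" "U \<subseteq> C"
    using locally_compact unfolding locally_compact_space_def
    by (simp add: compactin_euclidean_iff) metis
  obtain e where e: "e > 0" "\<And>y. av y < e \<Longrightarrow> y \<in> U"
    using U open_iff[of U] by fastforce
  obtain j :: nat where "(1 / real q) ^ j < e"
    using real_arch_pow_inv[of e "1 / real q"] e q_gt_1 by auto
  then have j: "real q powi (- int j) < e"
    by (simp add: power_int_minus power_one_over inverse_eq_divide)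
  have "level_ball (- int j) \<subseteq> C"
    using e(2) C(2) j by force
  then have *: "compact (level_ball (- int j))"
    using C(1) closed_level_ball by (metis compact_Int_closed inf.absorb_iff2)
  obtain a where a: "av a = real q powi (n + int j)"
    by (rule obtain_av)
  have "continuous_on (level_ball (- int j)) ((*) a)"
    unfolding continuous_on_def by (intro ballI tendsto_mult tendsto_const tendsto_ident_at)
  from compact_continuous_image[OF this *] show ?thesis
    using mult_level_ball[OF a] by simp
qed

section \<open>Residue classes as translates of a ball\<close>

abbreviation residue_rel where
  "residue_rel \<equiv> {(x, y). av x \<le> 1 \<and> av y \<le> 1 \<and> av (x - y) < 1}"

lemma equiv_residue_rel: "equiv {x. av x \<le> 1} residue_rel"
proof (rule equivI)
  show "trans residue_rel"
  proof (rule transI, clarsimp)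
    fix x y z assume "av (x - y) < 1" "av (y - z) < 1"
    then show "av (x - z) < 1"
      using ultrametric[of "x - y" "y - z"] by auto
  qed
qed (use av_minus_commute in \<open>force simp: refl_on_def sym_def\<close>)+

text \<open>A residue class is a coset of the open unit ball, which equals
  \<open>level_ball (- 1)\<close>; multiplication by \<open>a\<close> shifts the level by
  \<open>n\<close>.\<close>

lemma residue_class:
  assumes "C \<in> residue_field av" "av a = real q powi n"
  obtains b where "(*) a ` C = (+) b ` level_ball (n - 1)"
proof -
  obtain x where x: "av x \<le> 1" and "C = residue_rel `` {x}"
    using assms(1) unfolding residue_field_def by (auto elim!: quotientE)
  \<comment> \<open>The ultrametric inequality supplies the membership condition
    \<open>av y \<le> 1\<close>, since both \<open>x\<close> and \<open>y - x\<close> lie in the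
    unit ball.\<close>
  have "y \<in> C \<longleftrightarrow> y - x \<in> level_ball (- 1)" for y
    using x ultrametric[of "y - x" x] less_powi_iff[of "y - x" 0] \<open>C = _\<close>
    by (auto simp: av_minus_commute[of x])
  moreover have "y \<in> (+) x ` level_ball (- 1) \<longleftrightarrow> y - x \<in> level_ball (- 1)" for y
    by (metis (no_types, lifting) add_diff_cancel_left' diff_add_cancel add.commute image_iff)
  ultimately have C: "C = (+) x ` level_ball (- 1)"
    by blast
  have "(*) a ` C = (+) (a * x) ` (*) a ` level_ball (- 1)"
    unfolding C by (auto simp: image_image distrib_left)
  also have "(*) a ` level_ball (- 1) = level_ball (n - 1)"
    using mult_level_ball[OF assms(2), of "- 1"] by simp
  finally show ?thesis using that by blast
qed

section \<open>Haar measure of the balls\<close>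

lemma normalized_haar_measureD:
  assumes "normalized_haar_measure av M"
  shows "sets M = sets borel"
    and "A \<in> sets borel \<Longrightarrow> emeasure M ((+) a ` A) = emeasure M A"
    and "compact C \<Longrightarrow> emeasure M C < \<infinity>"
    and "emeasure M {x. av x \<le> 1} = 1"
proof -
  have "sets M = sets borel" "\<forall>a. \<forall>A\<in>sets borel. emeasure M ((+) a ` A) = emeasure M A"
    "\<forall>C. compact C \<longrightarrow> emeasure M C < \<infinity>" "emeasure M {x. av x \<le> 1} = 1"
    using assms unfolding normalized_haar_measure_def haar_measure_def
    by - (elim conjE, assumption)+
  then show "sets M = sets borel"
    and "A \<in> sets borel \<Longrightarrow> emeasure M ((+) a ` A) = emeasure M A"
    and "compact C \<Longrightarrow> emeasure M C < \<infinity>"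
    and "emeasure M {x. av x \<le> 1} = 1"
    by simp_all
qed

lemma level_ball_sets [measurable]:
  "normalized_haar_measure av M \<Longrightarrow> level_ball n \<in> sets M"
  using open_level_ball by (simp add: normalized_haar_measureD(1))

lemma emeasure_level_ball_finite:
  "normalized_haar_measure av M \<Longrightarrow> emeasure M (level_ball n) < \<infinity>"
  using compact_level_ball by (intro normalized_haar_measureD(3))

text \<open>Residue classes partition the unit ball. Multiplied by an element of value
  \<open>q ^ n\<close>, they partition \<open>level_ball n\<close> into \<open>q\<close> translates
  of \<open>level_ball (n - 1)\<close>.\<close>

lemma emeasure_level_ball_step:
  assumes M: "normalized_haar_measure av M"
  shows "emeasure M (level_ball n) = of_nat q * emeasure M (level_ball (n - 1))"
proof -
  obtain a where a: "a \<noteq> 0" "av a = real q powi n"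
    by (rule obtain_av)
  \<comment> \<open>An infinite set has \<open>card\<close> equal to 0, so \<open>q \<ge> 2\<close>
    forces finiteness.\<close>
  have fin: "finite (residue_field av)"
    using q_ge_2 by (metis card.infinite not_numeral_le_zero)
  have translate: "(*) a ` C \<in> sets M \<and> emeasure M ((*) a ` C) = emeasure M (level_ball (n - 1))"
    if C: "C \<in> residue_field av" for C
  proof -
    obtain b where b: "(*) a ` C = (+) b ` level_ball (n - 1)"
      by (rule residue_class[OF C a(2)])
    \<comment> \<open>Openness makes the translate measurable, as additivity over the partition
      requires.\<close>
    have "open ((+) b ` level_ball (n - 1))"
      unfolding open_iff
    proof clarify
      fix x assume x: "av x \<le> real q powi (n - 1)"
      have "y \<in> (+) b ` level_ball (n - 1)" if "av (y - (b + x)) < real q powi (n - 1)" for y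
      proof
        show "y - b \<in> level_ball (n - 1)"
          using x that ultrametric[of "y - (b + x)" x] by (auto simp: algebra_simps)
      qed simp
      then show "\<exists>e>0. \<forall>y. av (y - (b + x)) < e \<longrightarrow> y \<in> (+) b ` level_ball (n - 1)"
        using powi_pos by blast
    qed
    then show ?thesis
      using b open_level_ball by (simp add: normalized_haar_measureD(1,2)[OF M])
  qed
  have disj: "disjoint_family_on (\<lambda>C. (*) a ` C) (residue_field av)"
    unfolding disjoint_family_on_def
  proof (intro ballI impI)
    fix C D assume "C \<in> residue_field av" "D \<in> residue_field av" "C \<noteq> D"
    then have "C \<inter> D = {}"
      using quotient_disj[OF equiv_residue_rel] unfolding residue_field_def by blast
    then show "(*) a ` C \<inter> (*) a ` D = {}"
      using a(1) by auto
  qed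
  have "level_ball n = (*) a ` level_ball 0"
    using mult_level_ball[OF a(2), of 0] by simp
  also have "level_ball 0 = \<Union> (residue_field av)"
    unfolding residue_field_def using Union_quotient[OF equiv_residue_rel] by simp
  finally have "level_ball n = (\<Union>C\<in>residue_field av. (*) a ` C)"
    by (simp add: image_Union)
  then have "emeasure M (level_ball n) = (\<Sum>C\<in>residue_field av. emeasure M ((*) a ` C))"
    using translate fin disj by (subst sum_emeasure) auto
  also have "\<dots> = of_nat q * emeasure M (level_ball (n - 1))"
    using translate by simp
  finally show ?thesis .
qed

text \<open>The normalization fixes level 0; the step relation is then followed upwards and,
  dividing by \<open>q\<close>, downwards.\<close>

lemma measure_level_ball:
  assumes M: "normalized_haar_measure av M"
  shows "measure M (level_ball n) = real q powi n"
proof -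
  have step: "measure M (level_ball n) = real q * measure M (level_ball (n - 1))" for n
    unfolding measure_def emeasure_level_ball_step[OF M, of n]
    by (simp add: enn2real_mult)
  have q: "real q \<noteq> 0"
    using q_gt_1 by linarith
  show ?thesis
  proof (induction n rule: int_induct[where k = 0])
    case base
    then show ?case
      by (simp add: measure_def normalized_haar_measureD(4)[OF M])
  next
    case (step1 i)
    then show ?case
      using step[of "i + 1"] q by (simp add: power_int_add)
  next
    case (step2 i)
    then show ?case
      using step[of i] q by (simp add: power_int_diff field_simps)
  qed
qed

section \<open>Integrals over balls and spheres\<close>

abbreviation level_sphere where
  "level_sphere n \<equiv> level_ball n - level_ball (n - 1)"

lemma mem_level_sphere: "x \<in> level_sphere n \<longleftrightarrow> av x = real q powi n"
  using less_powi_iff[of x n] by auto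

lemma measure_level_sphere:
  assumes M: "normalized_haar_measure av M"
  shows "measure M (level_sphere n) = real q powi n - real q powi (n - 1)"
proof -
  have "measure M (level_sphere n) = measure M (level_ball n) - measure M (level_ball (n - 1))"
    using M emeasure_level_ball_finite[OF M, of n] powi_le_iff[of "n - 1" n]
    by (intro measure_Diff) auto
  then show ?thesis
    by (simp add: measure_level_ball[OF M])
qed

lemma level_sphere_integrable:
  assumes M: "normalized_haar_measure av M"
  shows "integrable M (indicator (level_sphere n) :: 'a \<Rightarrow> real)"
proof -
  have "emeasure M (level_sphere n) \<le> emeasure M (level_ball n)"
    using M by (intro emeasure_mono) auto
  then have "emeasure M (level_sphere n) < \<infinity>"
    using emeasure_level_ball_finite[OF M, of n] by order
  then show ?thesis
    using M by (intro integrable_real_indicator) auto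
qed

lemma level_ball_integrable:
  "locally_integrable M (\<lambda>x. \<phi> (av x)) \<Longrightarrow> set_integrable M (level_ball n) (\<lambda>x. \<phi> (av x))"
  using compact_level_ball by (simp add: locally_integrable_def)

text \<open>Serves two integrands of this shape: that of a ball with its outermost sphere split off,
  and that of the transform.\<close>

lemma integral_level_ball_plus_sphere:
  assumes M: "normalized_haar_measure av M"
    and \<phi>: "locally_integrable M (\<lambda>x. \<phi> (av x) :: complex)"
  shows "(LINT x|M. indicator (level_ball k) x *\<^sub>R \<phi> (av x) + indicator (level_sphere n) x *\<^sub>R c) =
    (LINT x:level_ball k|M. \<phi> (av x)) + of_real (real q powi n - real q powi (n - 1)) * c"
proof -
  have "level_sphere n \<subseteq> space M"
    using sets.sets_into_space[OF level_ball_sets[OF M, of n]] by blast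
  then have "(LINT x|M. indicator (level_sphere n) x *\<^sub>R c) = measure M (level_sphere n) *\<^sub>R c"
    using level_sphere_integrable[OF M, of n]
    by (subst integral_scaleR_left) (simp_all add: Int_absorb2)
  then show ?thesis
    using level_ball_integrable[where n = k, OF \<phi>] integrable_scaleR_left[OF level_sphere_integrable[OF M, of n], of c]
    by (simp add: set_lebesgue_integral_def set_integrable_def measure_level_sphere[OF M]
        scaleR_conv_of_real)
qed

text \<open>On the outermost sphere the radial function is constant, so that sphere contributes its
  measure times this value.\<close>

lemma integral_level_ball_step:
  assumes M: "normalized_haar_measure av M"
    and \<phi>: "locally_integrable M (\<lambda>x. \<phi> (av x) :: complex)"
  shows "(LINT x:level_ball n|M. \<phi> (av x)) =
    (LINT x:level_ball (n - 1)|M. \<phi> (av x)) +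
    of_real (real q powi n - real q powi (n - 1)) * \<phi> (real q powi n)"
proof -
  have "(LINT x:level_ball n|M. \<phi> (av x)) =
    (LINT x|M. indicator (level_ball (n - 1)) x *\<^sub>R \<phi> (av x) +
      indicator (level_sphere n) x *\<^sub>R \<phi> (real q powi n))"
    unfolding set_lebesgue_integral_def
  proof (rule Bochner_Integration.integral_cong)
    fix x
    show "indicator (level_ball n) x *\<^sub>R \<phi> (av x) =
      indicator (level_ball (n - 1)) x *\<^sub>R \<phi> (av x) +
      indicator (level_sphere n) x *\<^sub>R \<phi> (real q powi n)"
      using mem_level_sphere[of x n] powi_le_iff[of "n - 1" n]
      by (auto simp: indicator_def)
  qed simp
  then show ?thesis
    by (simp only: integral_level_ball_plus_sphere[OF M \<phi>])
qed

section \<open>The transform and its increments\<close>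

lemma laplace_transform_powi:
  assumes M: "normalized_haar_measure av M"
    and \<phi>: "locally_integrable M (\<lambda>x. \<phi> (av x) :: complex)"
  shows "laplace_transform av M \<phi> (real q powi N) =
    (LINT x:level_ball (- N)|M. \<phi> (av x)) - of_real (real q powi (- N)) * \<phi> (real q powi (1 - N))"
proof -
  obtain \<xi> where \<xi>: "av \<xi> = real q powi N"
    by (rule obtain_av)
  \<comment> \<open>The constant value of the integrand on the sphere
    \<open>av x = q ^ (1 - N)\<close>, which is where \<open>av (x * \<xi>) = q\<close>.\<close>
  define c where "c = - of_real (1 / (real q - 1)) * \<phi> (real q powi (1 - N))"
  have q: "real q \<noteq> 0"
    using q_gt_1 by linarith
  have "laplace_integral av M \<phi> \<xi> =
    (LINT x|M. indicator (level_ball (- N)) x *\<^sub>R \<phi> (av x) + indicator (level_sphere (1 - N)) x *\<^sub>R c)"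
    unfolding laplace_integral_def
  proof (rule Bochner_Integration.integral_cong)
    fix x
    have le: "av (x * \<xi>) \<le> 1 \<longleftrightarrow> x \<in> level_ball (- N)"
      using \<xi> powi_pos[of N] by (simp add: mult power_int_minus field_simps)
    have eq: "av (x * \<xi>) = real q \<longleftrightarrow> x \<in> level_sphere (1 - N)"
      unfolding mem_level_sphere
      using \<xi> powi_pos[of N] q by (simp add: mult power_int_diff field_simps)
    show "of_real (v0 q (av (x * \<xi>))) * \<phi> (av x) =
      indicator (level_ball (- N)) x *\<^sub>R \<phi> (av x) + indicator (level_sphere (1 - N)) x *\<^sub>R c"
      unfolding v0_def le eq using mem_level_sphere[of x "1 - N"]
      by (auto simp: c_def indicator_def)
  qed simp
  also have "\<dots> = (LINT x:level_ball (- N)|M. \<phi> (av x)) +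
      of_real (real q powi (1 - N) - real q powi (1 - N - 1)) * c"
    by (rule integral_level_ball_plus_sphere[OF M \<phi>])
  finally have "laplace_integral av M \<phi> \<xi> = (LINT x:level_ball (- N)|M. \<phi> (av x)) +
      of_real (real q powi (1 - N) - real q powi (1 - N - 1)) * c" .
  \<comment> \<open>The measure of the sphere contains the factor \<open>q - 1\<close>, which
    cancels the denominator in \<open>v0\<close>.\<close>
  moreover have "real q powi (1 - N) - real q powi (1 - N - 1) = real q powi (- N) * (real q - 1)"
    using power_int_add_1[OF disjI1[OF q], of "- N"] by (simp add: algebra_simps)
  moreover have "of_real (real q - 1) * c = - \<phi> (real q powi (1 - N))"
  proof -
    have "of_real (real q - 1) * complex_of_real (1 / (real q - 1)) = 1"
      using q_gt_1 unfolding of_real_mult[symmetric] by simp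
    then show ?thesis
      by (simp only: c_def mult_minus_left mult_minus_right mult.assoc[symmetric] mult_1_left)
  qed
  ultimately show ?thesis
    using laplace_transform_eq[of M \<phi> \<xi>] \<xi> by (simp only: of_real_mult mult.assoc) simp
qed

text \<open>The two ball integrals differ by
  \<open>(q ^ (- N) - q ^ (- N - 1)) * \<phi> (q ^ (- N))\<close>. The second part of this cancels
  against the correction term of the transform at \<open>q ^ (N + 1)\<close>, leaving a common
  factor \<open>q ^ (- N)\<close>.\<close>

lemma laplace_transform_increment:
  assumes M: "normalized_haar_measure av M"
    and \<phi>: "locally_integrable M (\<lambda>x. \<phi> (av x) :: complex)"
  shows "of_nat q powi N * (laplace_transform av M \<phi> (real q powi N) -
      laplace_transform av M \<phi> (real q powi (N + 1))) =
    \<phi> (real q powi (- N)) - \<phi> (real q powi (1 - N))"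
proof -
  have q: "(of_nat q :: complex) \<noteq> 0"
    using q_ge_2 by auto
  show ?thesis
    unfolding laplace_transform_powi[OF M \<phi>] integral_level_ball_step[OF M \<phi>, of "- N"]
    using q by (simp add: of_real_power_int power_int_diff power_int_minus field_simps)
qed

end

theorem theorem5:
  fixes av :: "'a::{field, topological_ab_group_add, topological_comm_monoid_mult,
               t2_space, perfect_space} \<Rightarrow> real"
    and \<mu> :: "'a measure"
    and \<phi> :: "real \<Rightarrow> complex"
    and q m :: nat
  assumes "nonarch_local_field TYPE('a)"
    and "local_field_absolute_value av"
    and "q = card (residue_field av)"
    and "normalized_haar_measure av \<mu>"
    and "locally_integrable \<mu> (\<lambda>x. \<phi> (av x))"
    and "m \<ge> 1"
  shows "\<phi> (real q powi int m) = \<phi> 1 + (\<Sum>j=0..m-1. of_nat q powi (- int j) *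
            (laplace_transform av \<mu> \<phi> (real q powi (- int j + 1))
             - laplace_transform av \<mu> \<phi> (real q powi (- int j))))
       \<and> \<phi> (real q powi (- int m)) = \<phi> 1 + (\<Sum>j=1..m. of_nat q powi int j *
            (laplace_transform av \<mu> \<phi> (real q powi int j)
             - laplace_transform av \<mu> \<phi> (real q powi (int j + 1))))"
proof -
  note incr = local_field_absolute_value.laplace_transform_increment
    [OF assms(2,4,5), folded assms(3)]
  \<comment> \<open>The increment at \<open>N = - j\<close> with both sides negated.\<close>
  have up: "of_nat q powi (- int j) * (laplace_transform av \<mu> \<phi> (real q powi (- int j + 1))
      - laplace_transform av \<mu> \<phi> (real q powi (- int j))) =
    \<phi> (real q powi int (Suc j)) - \<phi> (real q powi int j)" for j
    using incr[of "- int j"] by (simp add: algebra_simps)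
  \<comment> \<open>The increment at \<open>N = j\<close>; \<open>j \<ge> 1\<close> keeps the
    natural subtraction in \<open>int (j - 1)\<close> from truncating.\<close>
  have down: "of_nat q powi int j * (laplace_transform av \<mu> \<phi> (real q powi int j)
      - laplace_transform av \<mu> \<phi> (real q powi (int j + 1))) =
    \<phi> (real q powi (- int j)) - \<phi> (real q powi (- int (j - 1)))" if "j \<in> {1..m}" for j
    using incr[of "int j"] that by (simp add: of_nat_diff)
  \<comment> \<open>For \<open>m = 0\<close> the left side would be \<open>{0}\<close>, so
    \<open>m \<ge> 1\<close> enters here.\<close>
  have "{0..m - 1} = {..<m}"
    using \<open>m \<ge> 1\<close> by auto
  then have "(\<Sum>j=0..m-1. \<phi> (real q powi int (Suc j)) - \<phi> (real q powi int j)) =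
      \<phi> (real q powi int m) - \<phi> 1"
    using sum_lessThan_telescope[of "\<lambda>j. \<phi> (real q powi int j)" m] by simp
  moreover have "(\<Sum>j=1..m. \<phi> (real q powi (- int j)) - \<phi> (real q powi (- int (j - 1)))) =
      \<phi> (real q powi (- int m)) - \<phi> 1"
    using sum_telescope''[of 0 m "\<lambda>j. \<phi> (real q powi (- int j))"] by simp
  ultimately show ?thesis
    by (simp only: up down cong: sum.cong) simp
qed

end
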